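(* Let $\delta_2,\ldots,\delta_n$ be mean-independent mean-zero random variables with $|\delta_k|\le u$, i.e. $\mathbb{E}(\delta_k\mid\delta_2,\ldots,\delta_{k-1})=\mathbb{E}(\delta_k)=0$ for $2\le k\le n$. Let $h$ be the height of the computational tree for general summation of the real numbers $x_1,\ldots,x_n$, and $\lambda\equiv\sqrt{2\ln(2n/\eta)}$. For any $\eta>0$ with $\lambda\sqrt{h}\,u<1$ and any $\delta\in(0,1)$, with probability at least $1-(\delta+\eta)$, the error in general summation is bounded by $$|\hat{s}_n-s_n|\le \frac{u}{1-\lambda\sqrt{h}\,u}\left(\sum_{k=2}^n s_k^2\right)^{1/2}\sqrt{2\ln(2/\delta)}.$$
   Context: General summation of real numbers $x_1,\ldots,x_n$ ($n\ge 2$): start with the multiset $\mathcal{S}=\{x_1,\ldots,x_n\}$; for $k=2,\ldots,n$ remove two elements $x,y$ from $\mathcal{S}$, set $s_k=x+y$, and add $s_k$ to $\mathcal{S}$; the output is $s_n=\sum_{i=1}^n x_i$. The order of summation (which two elements are removed at each step) is fixed in advance. The computational tree is the binary tree with $2n-1$ vertices whose leaves are the inputs $x_1,\ldots,x_n$, whose internal vertices are the exact partial sums $s_2,\ldots,s_n$ (root $s_n$), where the two children of $s_k$ are the two elements $x,y$ with $s_k=x+y$. Its height $h$ is the length of the longest downward path from the root to a leaf. Floating point model (unit roundoff $0<u<1$, no overflow or underflow): inputs are stored exactly, and if $\hat{x},\hat{y}$ are the computed values of the children of $s_k$ (a leaf has computed value equal to its exact value), the computed value of $s_k$ is $\hat{s}_k=(\hat{x}+\hat{y})(1+\delta_k)$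 with $|\delta_k|\le u$, $2\le k\le n$. The $x_i$ (hence the $s_k$) are deterministic. *)

theory Defs
  imports "HOL-Probability.Probability" "HOL-Library.Multiset"
begin

text \<open>\<open>Input i\<close> is the leaf holding \<open>x\<^sub>i\<close>; \<open>Add k a b\<close> is the internal vertex created in
  step \<open>k\<close> (holding \<open>s\<^sub>k\<close>) from the vertices \<open>a\<close> and \<open>b\<close>.  The labels keep equal inputs and
  equal partial sums apart, and tie each addition to its rounding error.\<close>

datatype comp_tree = Input nat | Add nat comp_tree comp_tree

text \<open>\<open>t k\<close> is the computational tree of \<open>s\<^sub>k\<close>, so that \<open>t n\<close> is the whole tree; \<open>S k\<close> is the
  multiset after step \<open>k\<close>, with \<open>S 1\<close> the initial one.  Since it consists of trees
  instead of numbers, the order of summation cannot depend on computed values.\<close>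

definition general_summation :: "nat \<Rightarrow> (nat \<Rightarrow> comp_tree) \<Rightarrow> bool" where
  "general_summation n t \<longleftrightarrow>
     (\<exists>S :: nat \<Rightarrow> comp_tree multiset.
        S 1 = image_mset Input (mset_set {1..n}) \<and>
        (\<forall>k\<in>{2..n}. \<exists>a b. {#a, b#} \<subseteq># S (k - 1) \<and> t k = Add k a b \<and>
           S k = add_mset (t k) (S (k - 1) - {#a, b#})))"

primrec exact_value :: "(nat \<Rightarrow> real) \<Rightarrow> comp_tree \<Rightarrow> real" where
  "exact_value x (Input i) = x i"
| "exact_value x (Add k a b) = exact_value x a + exact_value x b"

primrec computed_value :: "(nat \<Rightarrow> real) \<Rightarrow> (nat \<Rightarrow> real) \<Rightarrow> comp_tree \<Rightarrow> real" where
  "computed_value x d (Input i) = x i"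
| "computed_value x d (Add k a b) = (computed_value x d a + computed_value x d b) * (1 + d k)"

primrec tree_height :: "comp_tree \<Rightarrow> nat" where
  "tree_height (Input i) = 0"
| "tree_height (Add k a b) = Suc (max (tree_height a) (tree_height b))"

text \<open>The \<open>\<sigma>\<close>-algebra generated by the random variables \<open>d i\<close>, \<open>i \<in> I\<close>; for \<open>I = {}\<close> it is
  the trivial one on \<open>space M\<close>, so conditioning on it is plain expectation.\<close>

definition generated_algebra ::
    "'a measure \<Rightarrow> (nat \<Rightarrow> 'a \<Rightarrow> real) \<Rightarrow> nat set \<Rightarrow> 'a measure" where
  "generated_algebra M d I =
     sigma (space M) {d i -` A \<inter> space M | i A. i \<in> I \<and> A \<in> sets borel}"

definition mean_independent_mean_zero ::
    "'a measure \<Rightarrow> nat \<Rightarrow> (nat \<Rightarrow> 'a \<Rightarrow> real) \<Rightarrow> bool" where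
  "mean_independent_mean_zero M n d \<longleftrightarrow>
     (\<forall>k\<in>{2..n}.
        (AE \<omega> in M. real_cond_exp M (generated_algebra M d {2..<k}) (d k) \<omega> =
                    integral\<^sup>L M (d k)) \<and>
        integral\<^sup>L M (d k) = 0)"

end

theory Submission imports Defs begin

text \<open>
  Unrolling \<open>s_hat k = (s_hat a + s_hat b) * (1 + d k)\<close> over the tree writes the error of a
  vertex \<open>T\<close> as \<open>\<Sum>j. d j * (s j + e j)\<close>, where \<open>j\<close> runs over the additions in \<open>T\<close> and
  \<open>e j\<close> is the error inherited from the two children of vertex \<open>j\<close>
  (\<open>sum_error_Add\<close>).  Since \<open>e j\<close> depends only on the \<open>d i\<close> with \<open>i < j\<close>, this is a sum of
  martingale differences, to which an inequality of Azuma--Hoeffding type applies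
  (\<open>weighted_sum_tail\<close>) as soon as the weights \<open>s j + e j\<close> are bounded by constants.

  The inequality itself provides these constants.  Put \<open>c = lam * u\<close> and define, from the leaves
  upwards, \<open>G j = \<bar>s j\<bar> + f j\<close> with \<open>f j = c * sqrt (\<Sum>i. (G i)\<^sup>2)\<close>, the sum being over the
  additions strictly below \<open>j\<close>.  If \<open>\<bar>e i\<bar> \<le> f i\<close> holds for all \<open>i\<close> below \<open>j\<close>, then
  \<open>\<bar>e j\<bar> \<le> f j\<close> fails with probability at most \<open>2 * exp (- lam\<^sup>2 / 2) = \<eta> / n\<close>.  To make this
  precise without conditioning on random events, a weight is replaced by \<open>0\<close> whenever
  \<open>\<bar>e j\<bar> > f j\<close>; the truncated weights are still predictable, they are bounded everywhere, and
  by induction on the tree they agree with the true ones unless one of the \<open>n - 1\<close> tail events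
  occurs (\<open>sum_error_eq_truncated_sum\<close>).  One more tail event, at the root and of probability at
  most \<open>\<delta>\<close>, bounds the final error by \<open>u * sqrt (\<Sum>j. (G j)\<^sup>2) * sqrt (2 * ln (2 / \<delta>))\<close>.

  It remains to estimate the constants.  In \<open>\<Sum>j. (f j)\<^sup>2\<close> the term \<open>c\<^sup>2 * (G i)\<^sup>2\<close> occurs once for each
  proper ancestor of \<open>i\<close>, hence at most \<open>h\<close> times (\<open>sum_inherited_bound_le_height\<close>).  Minkowski's
  inequality for \<open>G = \<bar>s\<bar> + f\<close> then gives \<open>\<parallel>G\<parallel> \<le> \<parallel>s\<parallel> + c * sqrt h * \<parallel>G\<parallel>\<close>, and solving for
  \<open>\<parallel>G\<parallel>\<close> produces the factor \<open>1 / (1 - lam * sqrt h * u)\<close> (\<open>sqrt_energy_le\<close>).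
\<close>

section \<open>Weighted sums of bounded martingale differences\<close>

text \<open>This is Hoeffding's estimate for a fair sign, with the parameter rescaled from
  \<open>{0, 1}\<close> to \<open>{-1, 1}\<close>.\<close>

lemma cosh_le_exp_half_square:
  fixes x :: real
  shows "cosh x \<le> exp (x\<^sup>2 / 2)"
proof -
  have nonneg: "cosh y \<le> exp (y\<^sup>2 / 2)" if "y \<ge> 0" for y :: real
  proof -
    have "- (2 * y) * (1/2) + ln (1 + 1/2 * (exp (2 * y) - 1)) \<le> (2 * y)\<^sup>2 / 8"
      by (rule Hoeffdings_lemma_aux) (use that in auto)
    moreover have "1 + 1/2 * (exp (2 * y) - 1) = exp y * cosh y"
      by (simp add: cosh_field_def exp_minus field_simps flip: exp_double)
        (simp add: power2_eq_square flip: exp_add)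
    ultimately have "ln (cosh y) \<le> y\<^sup>2 / 2"
      by (simp add: ln_mult power_mult_distrib)
    then show ?thesis
      by (metis cosh_real_pos exp_le_cancel_iff exp_ln)
  qed
  show ?thesis
  proof (cases "0 \<le> x")
    case False
    then show ?thesis using nonneg[of "- x"] by simp
  qed (rule nonneg)
qed

text \<open>By convexity the exponential lies below its chord over \<open>[-u, u]\<close>.  The chord is affine in
  \<open>z\<close>, so that in expectation a centred \<open>z\<close> contributes only the constant term
  \<open>cosh (a * u)\<close>.\<close>

lemma exp_le_cosh_sinh_chord:
  fixes a z u :: real
  assumes "0 < u" and "\<bar>z\<bar> \<le> u"
  shows "exp (a * z) \<le> cosh (a * u) + z / u * sinh (a * u)"
proof -
  define w where "w = z / u"
  have w: "z = w * u" "-1 \<le> w" "w \<le> 1"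
    using assms by (auto simp: w_def field_simps)
  define y where "y = (1 + w) / 2"
  have y: "0 \<le> y" "y \<le> 1" "1 - y = (1 - w) / 2"
    using w by (auto simp: y_def field_simps)
  have cvx: "convex_on UNIV (exp :: real \<Rightarrow> real)"
    using convex_on_exp[of 1] by simp
  have "a * z = (1 - y) * (- (a * u)) + y * (a * u)"
    unfolding y(3) y_def w(1) by (simp add: field_simps)
  then have "exp (a * z) = exp ((1 - y) *\<^sub>R (- (a * u)) + y *\<^sub>R (a * u))"
    by simp
  also have "\<dots> \<le> (1 - y) * exp (- (a * u)) + y * exp (a * u)"
    using y by (intro convex_onD[OF cvx]) auto
  also have "\<dots> = cosh (a * u) + w * sinh (a * u)"
    unfolding y(3) y_def cosh_field_def sinh_field_def by (simp add: field_simps)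
  finally show ?thesis by (simp add: w_def)
qed

text \<open>\<open>F k\<close> is the information available before \<open>d k\<close> is drawn.  It is indexed by the same set as
  the differences, so that \<open>g k\<close> is a predictable weight if it is \<open>F k\<close>-measurable.\<close>

locale bounded_martingale_differences = prob_space M for M :: "'a measure" +
  fixes F :: "'i :: linorder \<Rightarrow> 'a measure"
    and d :: "'i \<Rightarrow> 'a \<Rightarrow> real"
    and I :: "'i set"
    and u :: real
  assumes u_pos: "0 < u"
    and finite_I: "finite I"
    and subalg: "k \<in> I \<Longrightarrow> subalgebra M (F k)"
    and F_mono: "j \<in> I \<Longrightarrow> k \<in> I \<Longrightarrow> j < k \<Longrightarrow> subalgebra (F k) (F j)"
    and d_adapted: "j \<in> I \<Longrightarrow> k \<in> I \<Longrightarrow> j < k \<Longrightarrow> d j \<in> borel_measurable (F k)"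
    and d_measurable: "k \<in> I \<Longrightarrow> d k \<in> borel_measurable M"
    and d_bounded: "k \<in> I \<Longrightarrow> AE \<omega> in M. \<bar>d k \<omega>\<bar> \<le> u"
    and d_centred: "k \<in> I \<Longrightarrow> AE \<omega> in M. real_cond_exp M (F k) (d k) \<omega> = 0"
begin

lemma expectation_predictable_mult:
  assumes "k \<in> I" and W: "W \<in> borel_measurable (F k)" and "AE \<omega> in M. \<bar>W \<omega>\<bar> \<le> C"
  shows "integrable M (\<lambda>\<omega>. W \<omega> * d k \<omega>)" and "expectation (\<lambda>\<omega>. W \<omega> * d k \<omega>) = 0"
proof -
  interpret finite_measure_subalgebra M "F k"
    by unfold_locales (rule subalg[OF \<open>k \<in> I\<close>])
  have [measurable]: "W \<in> borel_measurable M" "d k \<in> borel_measurable M"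
    using measurable_from_subalg[OF subalg W] d_measurable assms(1) by auto
  show int: "integrable M (\<lambda>\<omega>. W \<omega> * d k \<omega>)"
  proof (rule integrable_const_bound)
    show "AE \<omega> in M. norm (W \<omega> * d k \<omega>) \<le> C * u"
      using assms(3) d_bounded[OF \<open>k \<in> I\<close>]
      by eventually_elim (auto simp: abs_mult intro!: mult_mono)
  qed measurable
  have "expectation (\<lambda>\<omega>. W \<omega> * d k \<omega>) = expectation (\<lambda>\<omega>. W \<omega> * real_cond_exp M (F k) (d k) \<omega>)"
    by (rule real_cond_exp_intg(2)[symmetric]) (use int W in auto)
  also have "\<dots> = expectation (\<lambda>\<omega>. 0)"
    by (rule integral_cong_AE) (use d_centred[OF \<open>k \<in> I\<close>] in auto)
  finally show "expectation (\<lambda>\<omega>. W \<omega> * d k \<omega>) = 0" by simp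
qed

lemma predictable_sum_measurable:
  assumes "J \<subseteq> I" and "k \<in> I" and "\<And>j. j \<in> J \<Longrightarrow> j < k"
    and "\<And>j. j \<in> J \<Longrightarrow> g j \<in> borel_measurable (F j)"
  shows "(\<lambda>\<omega>. \<Sum>j\<in>J. d j \<omega> * g j \<omega>) \<in> borel_measurable (F k)"
proof (intro borel_measurable_sum borel_measurable_times)
  fix j assume "j \<in> J"
  then have j: "j \<in> I" "j < k" using assms by auto
  show "d j \<in> borel_measurable (F k)" by (rule d_adapted) (use j assms in auto)
  show "g j \<in> borel_measurable (F k)"
    by (rule measurable_from_subalg[OF F_mono]) (use j assms \<open>j \<in> J\<close> in auto)
qed

lemma weighted_sum_measurable:
  assumes "J \<subseteq> I" and "\<And>j. j \<in> J \<Longrightarrow> g j \<in> borel_measurable (F j)"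
  shows "(\<lambda>\<omega>. \<Sum>j\<in>J. d j \<omega> * g j \<omega>) \<in> borel_measurable M"
  by (intro borel_measurable_sum borel_measurable_times d_measurable
      measurable_from_subalg[OF subalg assms(2)]) (use assms in auto)

lemma weighted_sum_bounded:
  assumes "J \<subseteq> I" and "\<And>j \<omega>. j \<in> J \<Longrightarrow> \<bar>g j \<omega>\<bar> \<le> G j"
  shows "AE \<omega> in M. \<bar>\<Sum>j\<in>J. d j \<omega> * g j \<omega>\<bar> \<le> (\<Sum>j\<in>J. u * G j)"
proof -
  have "AE \<omega> in M. \<forall>j\<in>J. \<bar>d j \<omega>\<bar> \<le> u"
    using assms finite_subset[OF _ finite_I] d_bounded by (auto simp: AE_ball_countable countable_finite)
  then show ?thesis
  proof eventually_elim
    case (elim \<omega>)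
    show ?case
      by (rule order.trans[OF sum_abs sum_mono])
        (use elim assms in \<open>auto simp: abs_mult intro!: mult_mono\<close>)
  qed
qed

text \<open>The largest index \<open>k\<close> is split off.  Given \<open>F k\<close>, everything except \<open>d k\<close> is fixed, and
  the chord bound is affine in \<open>d k\<close>: its linear part has expectation zero by
  \<open>expectation_predictable_mult\<close>, and its constant part costs a factor
  \<open>exp (t\<^sup>2 * u\<^sup>2 * (G k)\<^sup>2 / 2)\<close>.  This way only the conditional expectation of \<open>d k\<close> itself
  is needed, never that of its exponential.\<close>

lemma weighted_sum_mgf:
  assumes "J \<subseteq> I"
    and "\<And>j. j \<in> J \<Longrightarrow> g j \<in> borel_measurable (F j)"
    and "\<And>j \<omega>. j \<in> J \<Longrightarrow> \<bar>g j \<omega>\<bar> \<le> G j"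
  shows "integrable M (\<lambda>\<omega>. exp (t * (\<Sum>j\<in>J. d j \<omega> * g j \<omega>))) \<and>
    expectation (\<lambda>\<omega>. exp (t * (\<Sum>j\<in>J. d j \<omega> * g j \<omega>))) \<le> exp (t\<^sup>2 * u\<^sup>2 * (\<Sum>j\<in>J. (G j)\<^sup>2) / 2)"
  using finite_subset[OF assms(1) finite_I] assms
proof (induction J rule: finite_linorder_max_induct)
  case empty
  show ?case by (simp add: prob_space)
next
  case (insert k J)
  let ?Y = "\<lambda>\<omega>. \<Sum>j\<in>J. d j \<omega> * g j \<omega>"
  let ?E = "\<lambda>\<omega>. exp (t * ?Y \<omega>)"
  let ?H = "exp (t\<^sup>2 * u\<^sup>2 * (G k)\<^sup>2 / 2)"
  let ?W = "\<lambda>\<omega>. ?E \<omega> * (sinh (t * g k \<omega> * u) / u)"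
  define B where "B = (\<Sum>j\<in>J. u * G j)"
  have k: "k \<in> I" "k \<notin> J" "finite J" and J: "J \<subseteq> I" using insert by auto
  have meas: "\<And>j. j \<in> J \<Longrightarrow> g j \<in> borel_measurable (F j)"
    and bnd: "\<And>j \<omega>. j \<in> J \<Longrightarrow> \<bar>g j \<omega>\<bar> \<le> G j" using insert.prems by auto
  have IH: "integrable M ?E" "expectation ?E \<le> exp (t\<^sup>2 * u\<^sup>2 * (\<Sum>j\<in>J. (G j)\<^sup>2) / 2)"
    using insert.IH[OF J meas bnd] by auto
  have Y: "?Y \<in> borel_measurable (F k)"
    by (rule predictable_sum_measurable) (use insert k in auto)
  have gk: "g k \<in> borel_measurable (F k)" using insert.prems by auto
  have W: "?W \<in> borel_measurable (F k)"
    unfolding sinh_field_def using Y gk by measurable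
  have G: "\<bar>g k \<omega>\<bar> \<le> G k" for \<omega> using insert.prems by auto
  have Y_bnd: "AE \<omega> in M. \<bar>?Y \<omega>\<bar> \<le> B"
    unfolding B_def by (rule weighted_sum_bounded[OF J bnd])
  \<comment> \<open>A crude bound; it only serves the integrability of \<open>W * d k\<close>.\<close>
  have W_bnd: "AE \<omega> in M. \<bar>?W \<omega>\<bar> \<le> exp (\<bar>t\<bar> * B) * (exp (\<bar>t\<bar> * G k * u) / u)"
    using Y_bnd
  proof eventually_elim
    case (elim \<omega>)
    have "t * ?Y \<omega> \<le> \<bar>t\<bar> * B"
      by (rule order.trans[OF abs_ge_self]) (use elim in \<open>auto simp: abs_mult intro!: mult_left_mono\<close>)
    moreover have "\<bar>sinh (t * g k \<omega> * u)\<bar> \<le> exp (\<bar>t\<bar> * G k * u)"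
    proof -
      have "\<bar>sinh (t * g k \<omega> * u)\<bar> = sinh \<bar>t * g k \<omega> * u\<bar>" by simp
      also have "\<dots> \<le> exp \<bar>t * g k \<omega> * u\<bar>"
        using sinh_plus_cosh[of "\<bar>t * g k \<omega> * u\<bar>"] cosh_real_nonneg[of "\<bar>t * g k \<omega> * u\<bar>"]
        by linarith
      also have "\<dots> \<le> exp (\<bar>t\<bar> * G k * u)"
        using G[of \<omega>] u_pos by (auto simp: abs_mult intro!: mult_mono)
      finally show ?thesis .
    qed
    ultimately show ?case
      using u_pos by (auto simp: abs_mult intro!: mult_mono divide_right_mono)
  qed
  note Wd = expectation_predictable_mult[OF k(1) W W_bnd]
  have full_meas: "(\<lambda>\<omega>. \<Sum>j\<in>insert k J. d j \<omega> * g j \<omega>) \<in> borel_measurable M"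
    by (rule weighted_sum_measurable) (use insert.prems in auto)
  have pointwise: "AE \<omega> in M. exp (t * (\<Sum>j\<in>insert k J. d j \<omega> * g j \<omega>)) \<le> ?H * ?E \<omega> + ?W \<omega> * d k \<omega>"
    using d_bounded[OF k(1)]
  proof eventually_elim
    case (elim \<omega>)
    have "cosh (t * g k \<omega> * u) \<le> exp ((t * g k \<omega> * u)\<^sup>2 / 2)"
      by (rule cosh_le_exp_half_square)
    also have "\<dots> \<le> ?H"
      using power_mono[OF G[of \<omega>], of 2]
      by (auto simp: power_mult_distrib mult.commute mult.left_commute intro!: mult_left_mono)
    finally have cosh: "cosh (t * g k \<omega> * u) \<le> ?H" .
    have "exp (t * (\<Sum>j\<in>insert k J. d j \<omega> * g j \<omega>)) = ?E \<omega> * exp (t * g k \<omega> * d k \<omega>)"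
      using k by (simp add: distrib_left mult_ac flip: exp_add) (simp add: add.commute)?
    also have "\<dots> \<le> ?E \<omega> * (cosh (t * g k \<omega> * u) + d k \<omega> / u * sinh (t * g k \<omega> * u))"
      by (intro mult_left_mono exp_le_cosh_sinh_chord u_pos elim) auto
    also have "\<dots> = ?E \<omega> * cosh (t * g k \<omega> * u) + ?W \<omega> * d k \<omega>"
      by (simp add: algebra_simps)
    also have "\<dots> \<le> ?H * ?E \<omega> + ?W \<omega> * d k \<omega>"
      using cosh by (simp add: mult.commute)
    finally show ?case .
  qed
  have int_bound: "integrable M (\<lambda>\<omega>. ?H * ?E \<omega> + ?W \<omega> * d k \<omega>)"
    by (intro Bochner_Integration.integrable_add integrable_mult_right IH(1) Wd(1))
  have int: "integrable M (\<lambda>\<omega>. exp (t * (\<Sum>j\<in>insert k J. d j \<omega> * g j \<omega>)))"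
  proof (rule Bochner_Integration.integrable_bound[OF int_bound])
    show "(\<lambda>\<omega>. exp (t * (\<Sum>j\<in>insert k J. d j \<omega> * g j \<omega>))) \<in> borel_measurable M"
      using full_meas by measurable
    show "AE \<omega> in M. norm (exp (t * (\<Sum>j\<in>insert k J. d j \<omega> * g j \<omega>)))
        \<le> norm (?H * ?E \<omega> + ?W \<omega> * d k \<omega>)"
      using pointwise by eventually_elim auto
  qed
  have "expectation (\<lambda>\<omega>. exp (t * (\<Sum>j\<in>insert k J. d j \<omega> * g j \<omega>)))
      \<le> expectation (\<lambda>\<omega>. ?H * ?E \<omega> + ?W \<omega> * d k \<omega>)"
    by (rule integral_mono_AE[OF int int_bound pointwise])
  also have "\<dots> = ?H * expectation ?E"
    using IH(1) Wd by (subst Bochner_Integration.integral_add) auto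
  also have "\<dots> \<le> ?H * exp (t\<^sup>2 * u\<^sup>2 * (\<Sum>j\<in>J. (G j)\<^sup>2) / 2)"
    by (intro mult_left_mono IH(2)) auto
  also have "\<dots> = exp (t\<^sup>2 * u\<^sup>2 * (\<Sum>j\<in>insert k J. (G j)\<^sup>2) / 2)"
    using k by (simp add: field_simps flip: exp_add)
  finally show ?case using int by blast
qed

text \<open>Chernoff's method with the moment generating function above.  A vanishing variance proxy is
  excluded here because then the sum is \<open>0\<close>, which the non-strict event would contain.\<close>

lemma weighted_sum_upper_tail:
  assumes "J \<subseteq> I"
    and "\<And>j. j \<in> J \<Longrightarrow> g j \<in> borel_measurable (F j)"
    and "\<And>j \<omega>. j \<in> J \<Longrightarrow> \<bar>g j \<omega>\<bar> \<le> G j"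
    and V: "0 < (\<Sum>j\<in>J. (G j)\<^sup>2)" and "0 \<le> r"
  shows "prob {\<omega> \<in> space M. u * sqrt (\<Sum>j\<in>J. (G j)\<^sup>2) * r \<le> (\<Sum>j\<in>J. d j \<omega> * g j \<omega>)}
    \<le> exp (- r\<^sup>2 / 2)"
proof (cases "r = 0")
  case False
  let ?Y = "\<lambda>\<omega>. \<Sum>j\<in>J. d j \<omega> * g j \<omega>"
  define v where "v = u * sqrt (\<Sum>j\<in>J. (G j)\<^sup>2)"
  have v: "0 < v" "v\<^sup>2 = u\<^sup>2 * (\<Sum>j\<in>J. (G j)\<^sup>2)"
    using V u_pos by (auto simp: v_def power_mult_distrib)
  \<comment> \<open>The minimiser of \<open>exp (t\<^sup>2 * v\<^sup>2 / 2 - t * v * r)\<close>.\<close>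
  define t where "t = r / v"
  have t: "0 < t" using False \<open>0 \<le> r\<close> v by (simp add: t_def)
  note mgf = weighted_sum_mgf[OF assms(1-3), of t]
  have [measurable]: "?Y \<in> borel_measurable M"
    by (rule weighted_sum_measurable[OF assms(1,2)])
  have "{\<omega> \<in> space M. v * r \<le> ?Y \<omega>} = {\<omega> \<in> space M. exp (t * (v * r)) \<le> exp (t * ?Y \<omega>)}"
    using t by simp
  also have "prob \<dots> \<le> expectation (\<lambda>\<omega>. exp (t * ?Y \<omega>)) / exp (t * (v * r))"
    by (rule integral_Markov_inequality_measure[where A = "{}"]) (use mgf in auto)
  also have "\<dots> \<le> exp (t\<^sup>2 * u\<^sup>2 * (\<Sum>j\<in>J. (G j)\<^sup>2) / 2) / exp (t * (v * r))"
    using mgf by (intro divide_right_mono) auto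
  also have "\<dots> = exp (t\<^sup>2 * v\<^sup>2 / 2 - t * (v * r))"
    by (simp add: v(2) exp_diff mult.assoc)
  also have "t\<^sup>2 * v\<^sup>2 / 2 - t * (v * r) = - r\<^sup>2 / 2"
    using v(1) by (simp add: t_def power_divide) (simp add: power2_eq_square)
  finally show ?thesis by (simp add: v_def)
qed simp

text \<open>The strict inequality in the event makes the statement true also if all \<open>G j\<close> vanish.\<close>

lemma weighted_sum_tail:
  assumes "J \<subseteq> I"
    and "\<And>j. j \<in> J \<Longrightarrow> g j \<in> borel_measurable (F j)"
    and bnd: "\<And>j \<omega>. j \<in> J \<Longrightarrow> \<bar>g j \<omega>\<bar> \<le> G j"
    and "0 \<le> r"
  shows "prob {\<omega> \<in> space M. u * sqrt (\<Sum>j\<in>J. (G j)\<^sup>2) * r < \<bar>\<Sum>j\<in>J. d j \<omega> * g j \<omega>\<bar>}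
    \<le> 2 * exp (- r\<^sup>2 / 2)"
proof (cases "(\<Sum>j\<in>J. (G j)\<^sup>2) = 0")
  case True
  then have "\<forall>j\<in>J. G j = 0"
    using finite_subset[OF assms(1) finite_I] by (simp add: sum_nonneg_eq_0_iff)
  then have "g j \<omega> = 0" if "j \<in> J" for j \<omega> using bnd[OF that, of \<omega>] that by simp
  then have "{\<omega> \<in> space M. u * sqrt (\<Sum>j\<in>J. (G j)\<^sup>2) * r < \<bar>\<Sum>j\<in>J. d j \<omega> * g j \<omega>\<bar>} = {}"
    unfolding True by simp
  then show ?thesis by (simp only: measure_empty) simp
next
  case False
  then have V: "0 < (\<Sum>j\<in>J. (G j)\<^sup>2)"
    by (simp add: order_less_le sum_nonneg)
  let ?c = "u * sqrt (\<Sum>j\<in>J. (G j)\<^sup>2) * r"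
  let ?Y = "\<lambda>\<omega>. \<Sum>j\<in>J. d j \<omega> * g j \<omega>"
  have [measurable]: "?Y \<in> borel_measurable M"
    by (rule weighted_sum_measurable[OF assms(1,2)])
  have neg: "(\<Sum>j\<in>J. d j \<omega> * - g j \<omega>) = - ?Y \<omega>" for \<omega>
    by (simp add: sum_negf)
  have upper: "prob {\<omega> \<in> space M. ?c \<le> ?Y \<omega>} \<le> exp (- r\<^sup>2 / 2)"
    by (rule weighted_sum_upper_tail) (use assms V in auto)
  have "prob {\<omega> \<in> space M. ?c \<le> (\<Sum>j\<in>J. d j \<omega> * - g j \<omega>)} \<le> exp (- r\<^sup>2 / 2)"
    by (rule weighted_sum_upper_tail) (use assms V in auto)
  then have lower: "prob {\<omega> \<in> space M. ?c \<le> - ?Y \<omega>} \<le> exp (- r\<^sup>2 / 2)"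
    unfolding neg .
  have split: "c \<le> y \<or> c \<le> - y" if "c < \<bar>y\<bar>" for c y :: real
    using that by linarith
  have "prob {\<omega> \<in> space M. ?c < \<bar>?Y \<omega>\<bar>}
      \<le> prob ({\<omega> \<in> space M. ?c \<le> ?Y \<omega>} \<union> {\<omega> \<in> space M. ?c \<le> - ?Y \<omega>})"
  proof (rule finite_measure_mono)
    show "{\<omega> \<in> space M. ?c < \<bar>?Y \<omega>\<bar>}
        \<subseteq> {\<omega> \<in> space M. ?c \<le> ?Y \<omega>} \<union> {\<omega> \<in> space M. ?c \<le> - ?Y \<omega>}"
      using split by blast
  qed measurable
  also have "\<dots> \<le> prob {\<omega> \<in> space M. ?c \<le> ?Y \<omega>} + prob {\<omega> \<in> space M. ?c \<le> - ?Y \<omega>}"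
    by (rule measure_Un_le) measurable
  also have "\<dots> \<le> exp (- r\<^sup>2 / 2) + exp (- r\<^sup>2 / 2)"
    by (rule add_mono[OF upper lower])
  finally show ?thesis by simp
qed

end


section \<open>Computational trees\<close>

text \<open>A multiset, so that sums over the additions in a tree split over the two subtrees before
  the labels are known to be distinct.\<close>

primrec labels :: "comp_tree \<Rightarrow> nat multiset" where
  "labels (Input i) = {#}"
| "labels (Add k a b) = add_mset k (labels a + labels b)"

text \<open>Every internal vertex is the vertex \<open>t k\<close> belonging to its own label \<open>k\<close>, and the labels
  below it are distinct and earlier.  This is all that the order of summation has to guarantee:
  it lets \<open>t j\<close> stand for the vertex with label \<open>j\<close>, and it makes the error inherited at step
  \<open>k\<close> depend on earlier rounding errors only.\<close>

primrec step_vertices :: "(nat \<Rightarrow> comp_tree) \<Rightarrow> comp_tree \<Rightarrow> bool" where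
  "step_vertices t (Input i) \<longleftrightarrow> True"
| "step_vertices t (Add k a b) \<longleftrightarrow>
     t k = Add k a b \<and> labels a + labels b \<subseteq># mset_set {2..<k} \<and>
     step_vertices t a \<and> step_vertices t b"

text \<open>Each step moves the labels of two trees into one new tree and adds the single label \<open>k\<close>, so
  after step \<open>k\<close> the labels of all trees together are exactly \<open>{2..k}\<close>, each occurring once.
  As a multiset equation this invariant contains both the disjointness of the two merged trees
  and the bound on their labels.\<close>

lemma general_summation_step_vertices:
  assumes "general_summation n t" and "2 \<le> k" and "k \<le> n"
  shows "step_vertices t (t k)" and "labels (t k) \<subseteq># mset_set {2..k}"
proof -
  obtain S where S1: "S 1 = image_mset Input (mset_set {1..n})"
    and step: "\<And>k. k \<in> {2..n} \<Longrightarrow> \<exists>a b. {#a, b#} \<subseteq># S (k - 1) \<and> t k = Add k a b \<and>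
      S k = add_mset (t k) (S (k - 1) - {#a, b#})"
    using assms(1) unfolding general_summation_def by blast
  have one_step: "(\<Sum>T\<in>#S k. labels T) = mset_set {2..k} \<and> (\<forall>T\<in>#S k. step_vertices t T) \<and>
      t k \<in># S k"
    if sums: "(\<Sum>T\<in>#S (k - 1). labels T) = mset_set {2..k - 1}"
      and verts: "\<forall>T\<in>#S (k - 1). step_vertices t T" and k: "k \<in> {2..n}" for k
  proof -
    obtain a b where ab: "{#a, b#} \<subseteq># S (k - 1)" "t k = Add k a b"
      "S k = add_mset (t k) (S (k - 1) - {#a, b#})"
      using step[OF k] by blast
    define R where "R = S (k - 1) - {#a, b#}"
    have R: "S (k - 1) = {#a, b#} + R" using subset_mset.add_diff_inverse[OF ab(1)] by (simp only: R_def)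
    have Sk: "S k = add_mset (t k) R" unfolding ab(3) R_def ..
    have lab: "labels a + labels b + (\<Sum>T\<in>#R. labels T) = mset_set {2..k - 1}"
      using sums unfolding R by (simp add: ac_simps)
    have "{2..k} = insert k {2..k - 1}" "{2..<k} = {2..k - 1}" "k \<notin> {2..k - 1}"
      using k by auto
    then have iv: "mset_set {2..k} = add_mset k (mset_set {2..k - 1})"
      "mset_set {2..<k} = mset_set {2..k - 1}" by auto
    have "(\<Sum>T\<in>#S k. labels T) = mset_set {2..k}"
      unfolding Sk iv lab[symmetric] by (simp add: ab(2))
    moreover have "labels a + labels b \<subseteq># mset_set {2..<k}"
      unfolding iv lab[symmetric] by simp
    moreover have "step_vertices t T" if "T \<in># {#a, b#} + R" for T
      using that verts unfolding R by blast
    ultimately show ?thesis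
      unfolding Sk ab(2) using ab(2) by auto
  qed
  have inv: "(\<Sum>T\<in>#S m. labels T) = mset_set {2..m} \<and> (\<forall>T\<in>#S m. step_vertices t T)"
    if "1 \<le> m" "m \<le> n" for m
    using that
  proof (induction m rule: dec_induct)
    case base
    show ?case unfolding S1 by (auto simp: image_mset.compositionality comp_def)
  next
    case (step m)
    then show ?case using one_step[of "Suc m"] by simp
  qed
  have sum: "(\<Sum>T\<in>#S k. labels T) = mset_set {2..k}" and all: "\<forall>T\<in>#S k. step_vertices t T"
    and mem: "t k \<in># S k"
    using one_step[of k] inv[of "k - 1"] assms(2,3) by auto
  show "step_vertices t (t k)" using all mem by blast
  obtain R where "S k = add_mset (t k) R" using mem by (blast dest: multi_member_split)
  then show "labels (t k) \<subseteq># mset_set {2..k}" by (simp flip: sum)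
qed

lemma step_vertices_label:
  assumes "step_vertices t T" and "j \<in># labels T"
  obtains a b where "t j = Add j a b" "step_vertices t (t j)"
    and "labels a + labels b \<subseteq># mset_set {2..<j}" "labels a + labels b \<subseteq># labels T"
proof -
  have "\<exists>a b. t j = Add j a b \<and> step_vertices t (t j) \<and>
      labels a + labels b \<subseteq># mset_set {2..<j} \<and> labels a + labels b \<subseteq># labels T"
    using assms
  proof (induction T)
    case (Add k a b)
    have sub: "labels a \<subseteq># labels (Add k a b)" "labels b \<subseteq># labels (Add k a b)"
      "labels a + labels b \<subseteq># labels (Add k a b)"
      by (auto simp: subseteq_mset_def)
    consider "j = k" | "j \<in># labels a" | "j \<in># labels b" using Add.prems(2) by auto
    then show ?case
    proof cases
      case 1
      then show ?thesis using Add.prems(1) sub(3)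
        by (intro exI[of _ a] exI[of _ b]) simp
    next
      case 2
      then show ?thesis using Add.prems(1) Add.IH(1) sub(1) subset_mset.order_trans
        unfolding step_vertices.simps by blast
    next
      case 3
      then show ?thesis using Add.prems(1) Add.IH(2) sub(2) subset_mset.order_trans
        unfolding step_vertices.simps by blast
    qed
  qed simp
  then show thesis using that by blast
qed

lemma sum_mset_eq_sum_if_subset_mset_set:
  fixes f :: "'b \<Rightarrow> 'c :: comm_monoid_add"
  assumes "A \<subseteq># mset_set B" and "finite B"
  shows "(\<Sum>j\<in>#A. f j) = (\<Sum>j\<in>set_mset A. f j)"
proof -
  have "A = mset_set (set_mset A)"
  proof (rule multiset_eqI)
    fix y
    have "count A y \<le> count (mset_set B) y" using assms(1) by (simp add: mset_subset_eq_count)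
    also have "\<dots> \<le> 1" by (simp add: count_mset_set')
    finally have le: "count A y \<le> 1" .
    show "count A y = count (mset_set (set_mset A)) y"
    proof (cases "y \<in># A")
      case True
      then have "count A y = 1" using le by (metis count_greater_eq_one_iff le_antisym)
      with True show ?thesis by simp
    next
      case False
      then show ?thesis by (simp add: count_eq_zero_iff)
    qed
  qed
  then show ?thesis by (metis sum_unfold_sum_mset)
qed

section \<open>Local errors\<close>

definition sum_error :: "(nat \<Rightarrow> real) \<Rightarrow> (nat \<Rightarrow> real) \<Rightarrow> comp_tree \<Rightarrow> real" where
  "sum_error x \<epsilon> T = computed_value x \<epsilon> T - exact_value x T"

primrec inherited_error :: "(nat \<Rightarrow> real) \<Rightarrow> (nat \<Rightarrow> real) \<Rightarrow> comp_tree \<Rightarrow> real" where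
  "inherited_error x \<epsilon> (Input i) = 0"
| "inherited_error x \<epsilon> (Add k a b) = sum_error x \<epsilon> a + sum_error x \<epsilon> b"

lemma sum_error_Input [simp]: "sum_error x \<epsilon> (Input i) = 0"
  by (simp add: sum_error_def)

text \<open>Each addition contributes its own rounding error, relative to the sum of the computed
  children.  Iterated, this is the martingale representation of the total error.\<close>

lemma sum_error_Add:
  "sum_error x \<epsilon> (Add k a b) = sum_error x \<epsilon> a + sum_error x \<epsilon> b +
     \<epsilon> k * (exact_value x (Add k a b) + inherited_error x \<epsilon> (Add k a b))"
  by (simp add: sum_error_def algebra_simps)

lemma computed_value_measurable:
  assumes "\<And>j. j \<in># labels T \<Longrightarrow> d j \<in> borel_measurable N"
  shows "(\<lambda>\<omega>. computed_value x (\<lambda>j. d j \<omega>) T) \<in> borel_measurable N"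
  using assms
proof (induction T)
  case (Add k a b)
  have [measurable]: "(\<lambda>\<omega>. computed_value x (\<lambda>j. d j \<omega>) a) \<in> borel_measurable N"
    "(\<lambda>\<omega>. computed_value x (\<lambda>j. d j \<omega>) b) \<in> borel_measurable N"
    "d k \<in> borel_measurable N"
    using Add by auto
  show ?case by simp
qed simp

text \<open>The sum of the squares of \<open>local_bound\<close> over the additions in the tree (\<open>energy_eq_sum\<close>),
  unfolded into one recursion because each local bound refers to the sum over the additions
  below it.  The parameter \<open>c\<close> is \<open>lam * u\<close> in the application.\<close>

primrec energy :: "real \<Rightarrow> (nat \<Rightarrow> real) \<Rightarrow> comp_tree \<Rightarrow> real" where
  "energy c x (Input i) = 0"
| "energy c x (Add k a b) = energy c x a + energy c x b +
     (\<bar>exact_value x (Add k a b)\<bar> + c * sqrt (energy c x a + energy c x b))\<^sup>2"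

text \<open>The threshold for \<open>inherited_error\<close>: the two subtrees have together the variance proxy
  \<open>u\<^sup>2 * (energy c x a + energy c x b)\<close>, and \<open>c = lam * u\<close> allows \<open>lam\<close> times its square root.\<close>

primrec inherited_bound :: "real \<Rightarrow> (nat \<Rightarrow> real) \<Rightarrow> comp_tree \<Rightarrow> real" where
  "inherited_bound c x (Input i) = 0"
| "inherited_bound c x (Add k a b) = c * sqrt (energy c x a + energy c x b)"

definition local_bound :: "real \<Rightarrow> (nat \<Rightarrow> real) \<Rightarrow> comp_tree \<Rightarrow> real" where
  "local_bound c x T = \<bar>exact_value x T\<bar> + inherited_bound c x T"

lemma energy_nonneg: "0 \<le> energy c x T"
  by (induction T) auto

lemma inherited_bound_nonneg: "0 \<le> c \<Longrightarrow> 0 \<le> inherited_bound c x T"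
  by (cases T) (auto simp: energy_nonneg)

lemma energy_eq_sum:
  "step_vertices t T \<Longrightarrow> energy c x T = (\<Sum>j\<in>#labels T. (local_bound c x (t j))\<^sup>2)"
  by (induction T) (auto simp: local_bound_def)

text \<open>The energy of a vertex enters once for each of its proper ancestors, and there are at most as
  many as the tree is high.\<close>

lemma sum_inherited_bound_le_height:
  assumes "0 \<le> c"
  shows "step_vertices t T \<Longrightarrow>
    (\<Sum>j\<in>#labels T. (inherited_bound c x (t j))\<^sup>2) \<le> c\<^sup>2 * real (tree_height T) * energy c x T"
proof (induction T)
  case (Add k a b)
  let ?h = "max (tree_height a) (tree_height b)" and ?E = "energy c x a + energy c x b"
  have part: "c\<^sup>2 * real (tree_height a) * energy c x a \<le> c\<^sup>2 * real ?h * energy c x a"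
    "c\<^sup>2 * real (tree_height b) * energy c x b \<le> c\<^sup>2 * real ?h * energy c x b"
    by (intro mult_right_mono mult_left_mono; simp add: energy_nonneg)+
  have "(\<Sum>j\<in>#labels (Add k a b). (inherited_bound c x (t j))\<^sup>2)
      = (inherited_bound c x (Add k a b))\<^sup>2 + ((\<Sum>j\<in>#labels a. (inherited_bound c x (t j))\<^sup>2)
        + (\<Sum>j\<in>#labels b. (inherited_bound c x (t j))\<^sup>2))"
    using Add.prems by simp
  also have "\<dots> \<le> c\<^sup>2 * ?E + (c\<^sup>2 * real (tree_height a) * energy c x a
      + c\<^sup>2 * real (tree_height b) * energy c x b)"
    using Add by (intro add_mono) (auto simp: power_mult_distrib energy_nonneg)
  also have "\<dots> \<le> c\<^sup>2 * ?E + (c\<^sup>2 * real ?h * energy c x a + c\<^sup>2 * real ?h * energy c x b)"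
    by (intro add_left_mono add_mono part)
  also have "\<dots> = c\<^sup>2 * real (tree_height (Add k a b)) * ?E"
    by (simp add: algebra_simps)
  also have "\<dots> \<le> c\<^sup>2 * real (tree_height (Add k a b)) * energy c x (Add k a b)"
    by (intro mult_left_mono) auto
  finally show ?case .
qed simp

text \<open>The energy is the squared Euclidean norm of \<open>\<bar>s\<bar> + f\<close>, where \<open>f\<close> collects the inherited
  bounds.  By the previous lemma the norm of \<open>f\<close> is at most \<open>c * sqrt h\<close> times that of the
  whole, so the triangle inequality can be solved for the latter.\<close>

lemma sqrt_energy_le:
  assumes "0 \<le> c" and "step_vertices t T" and "labels T \<subseteq># mset_set B" and "finite B"
    and small: "c * sqrt (real (tree_height T)) < 1"
  shows "sqrt (energy c x T) \<le>
    sqrt (\<Sum>j\<in>B. (exact_value x (t j))\<^sup>2) / (1 - c * sqrt (real (tree_height T)))"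
proof -
  let ?J = "set_mset (labels T)"
  have J: "?J \<subseteq> B"
    using set_mset_mono[OF assms(3)] \<open>finite B\<close> by simp
  note to_set = sum_mset_eq_sum_if_subset_mset_set[OF assms(3,4)]
  have "sqrt (energy c x T) = L2_set (\<lambda>j. \<bar>exact_value x (t j)\<bar> + inherited_bound c x (t j)) ?J"
    by (simp add: energy_eq_sum[OF assms(2)] to_set L2_set_def local_bound_def)
  also have "\<dots> \<le> L2_set (\<lambda>j. \<bar>exact_value x (t j)\<bar>) ?J + L2_set (\<lambda>j. inherited_bound c x (t j)) ?J"
    by (rule L2_set_triangle_ineq)
  also have "L2_set (\<lambda>j. \<bar>exact_value x (t j)\<bar>) ?J \<le> sqrt (\<Sum>j\<in>B. (exact_value x (t j))\<^sup>2)"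
    unfolding L2_set_def using J \<open>finite B\<close> by (auto intro!: sum_mono2)
  also have "L2_set (\<lambda>j. inherited_bound c x (t j)) ?J
      \<le> sqrt (c\<^sup>2 * real (tree_height T) * energy c x T)"
    using sum_inherited_bound_le_height[OF assms(1,2)] by (simp add: L2_set_def to_set)
  also have "\<dots> = c * sqrt (real (tree_height T)) * sqrt (energy c x T)"
    using \<open>0 \<le> c\<close> by (simp add: real_sqrt_mult)
  finally show ?thesis
    using small by (simp add: field_simps)
qed

text \<open>The true weight of \<open>\<epsilon> k\<close> at a vertex with label \<open>k\<close>, set to \<open>0\<close> if the inherited error
  exceeds its threshold.  Whether this happens is decided before step \<open>k\<close>, so truncation keeps
  the weight predictable and makes it bounded for every outcome.\<close>

definition truncated_weight :: "real \<Rightarrow> (nat \<Rightarrow> real) \<Rightarrow> (nat \<Rightarrow> real) \<Rightarrow> comp_tree \<Rightarrow> real" where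
  "truncated_weight c x \<epsilon> T =
     (if \<bar>inherited_error x \<epsilon> T\<bar> \<le> inherited_bound c x T then
        exact_value x T + inherited_error x \<epsilon> T else 0)"

lemma abs_truncated_weight_le:
  assumes "0 \<le> c"
  shows "\<bar>truncated_weight c x \<epsilon> T\<bar> \<le> local_bound c x T"
  using inherited_bound_nonneg[OF assms, of x T]
  by (auto simp: truncated_weight_def local_bound_def)

lemma truncated_weight_measurable:
  assumes "\<And>j. j \<in># labels a + labels b \<Longrightarrow> d j \<in> borel_measurable N"
  shows "(\<lambda>\<omega>. truncated_weight c x (\<lambda>j. d j \<omega>) (Add k a b)) \<in> borel_measurable N"
proof -
  have [measurable]: "(\<lambda>\<omega>. computed_value x (\<lambda>j. d j \<omega>) a) \<in> borel_measurable N"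
    "(\<lambda>\<omega>. computed_value x (\<lambda>j. d j \<omega>) b) \<in> borel_measurable N"
    using assms by (auto intro!: computed_value_measurable)
  show ?thesis
    unfolding truncated_weight_def inherited_error.simps sum_error_def by measurable
qed

text \<open>The hypothesis concerns only truncated sums, for which tail bounds are available.  From the
  leaves upwards it shows that no truncation has taken place: below a vertex the truncated sum
  is the inherited error, so the inherited error obeys its threshold and the next weight is the
  true one.\<close>

lemma sum_error_eq_truncated_sum:
  assumes "step_vertices t T"
    and "\<And>k a b. k \<in># labels T \<Longrightarrow> t k = Add k a b \<Longrightarrow>
      \<bar>\<Sum>j\<in>#labels a + labels b. \<epsilon> j * truncated_weight c x \<epsilon> (t j)\<bar> \<le> inherited_bound c x (t k)"
  shows "sum_error x \<epsilon> T = (\<Sum>j\<in>#labels T. \<epsilon> j * truncated_weight c x \<epsilon> (t j))"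
  using assms
proof (induction T)
  case (Add k a b)
  let ?S = "\<lambda>T. \<Sum>j\<in>#labels T. \<epsilon> j * truncated_weight c x \<epsilon> (t j)"
  have tk: "t k = Add k a b" using Add.prems by simp
  have ab: "sum_error x \<epsilon> a = ?S a" "sum_error x \<epsilon> b = ?S b"
    using Add by auto
  have "\<bar>inherited_error x \<epsilon> (t k)\<bar> \<le> inherited_bound c x (t k)"
    using Add.prems(2)[OF _ tk] unfolding tk by (simp add: ab)
  then show ?case
    unfolding sum_error_Add
    by (simp add: ab truncated_weight_def tk)
qed simp

section \<open>The probabilistic error bound\<close>

lemma generated_algebra_measurable:
  assumes "i \<in> I"
  shows "d i \<in> borel_measurable (generated_algebra M d I)"
proof (rule measurableI)
  fix A :: "real set" assume "A \<in> sets borel"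
  then have "d i -` A \<inter> space M \<in> {d i -` A \<inter> space M | i A. i \<in> I \<and> A \<in> sets borel}"
    using assms by blast
  then show "d i -` A \<inter> space (generated_algebra M d I) \<in> sets (generated_algebra M d I)"
    unfolding generated_algebra_def by (auto simp: space_measure_of_conv intro!: in_measure_of)
qed simp

text \<open>The generated algebra is the smallest one that makes the variables measurable.  With \<open>N = M\<close>
  it is a subalgebra of the whole space, and with \<open>N\<close> generated by more variables this gives the
  monotonicity of the filtration.\<close>

lemma subalgebra_generated_algebra:
  assumes "space N = space M" and "\<And>i. i \<in> I \<Longrightarrow> d i \<in> borel_measurable N"
  shows "subalgebra N (generated_algebra M d I)"
proof -
  have "{d i -` A \<inter> space M | i A. i \<in> I \<and> A \<in> sets borel} \<subseteq> sets N"
    using measurable_sets[OF assms(2)] by (auto simp: assms(1))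
  then show ?thesis
    unfolding subalgebra_def generated_algebra_def
    using sets.sigma_sets_subset[of _ N] sets.top[of N] by (simp add: space_measure_of_conv assms(1) sets_measure_of_conv)
qed

theorem theorem2p8:
  fixes M :: "'a measure"
    and n h :: nat
    and x s :: "nat \<Rightarrow> real"
    and t :: "nat \<Rightarrow> comp_tree"
    and d :: "nat \<Rightarrow> 'a \<Rightarrow> real"
    and s_hat :: "nat \<Rightarrow> 'a \<Rightarrow> real"
    and u \<eta> \<delta> lam :: real
  assumes "n \<ge> 2"
    and "general_summation n t"
    and "0 < u" and "u < 1"
    and "prob_space M"
    and "\<And>k. k \<in> {2..n} \<Longrightarrow> d k \<in> borel_measurable M"
    and "\<And>k. k \<in> {2..n} \<Longrightarrow> AE \<omega> in M. \<bar>d k \<omega>\<bar> \<le> u"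
    and "mean_independent_mean_zero M n d"
    and "\<And>k. s k = exact_value x (t k)"
    and "\<And>k \<omega>. s_hat k \<omega> = computed_value x (\<lambda>j. d j \<omega>) (t k)"
    and "h = tree_height (t n)"
    and "lam = sqrt (2 * ln (2 * real n / \<eta>))"
    and "\<eta> > 0"
    and "lam * sqrt (real h) * u < 1"
    and "\<delta> \<in> {0<..<1}"
  shows "measure M {\<omega> \<in> space M.
            \<bar>s_hat n \<omega> - s n\<bar> \<le>
              u / (1 - lam * sqrt (real h) * u) * sqrt (\<Sum>k=2..n. (s k)\<^sup>2) * sqrt (2 * ln (2 / \<delta>))}
          \<ge> 1 - (\<delta> + \<eta>)"
proof (cases "\<eta> < 1")
  case False
  \<comment> \<open>The claimed probability is not positive.  For \<open>\<eta> > 2 * n\<close> the square root defining \<open>lam\<close>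
    would be that of a negative number, so this case has to be treated apart.\<close>
  then have "1 - (\<delta> + \<eta>) \<le> 0" using assms(15) by simp
  then show ?thesis using measure_nonneg order_trans by blast
next
  case True
  let ?F = "\<lambda>k. generated_algebra M d {2..<k}" and ?B = "{2..n}"
  interpret prob_space M by fact
  interpret bounded_martingale_differences M ?F d ?B u
  proof
    fix j k assume jk: "j \<in> ?B" "k \<in> ?B" "j < k"
    then show "d j \<in> borel_measurable (?F k)" by (intro generated_algebra_measurable) auto
    show "subalgebra (?F k) (?F j)"
      by (intro subalgebra_generated_algebra generated_algebra_measurable)
        (use jk in \<open>auto simp: generated_algebra_def space_measure_of_conv\<close>)
  next
    fix k assume k: "k \<in> ?B"
    show "subalgebra M (?F k)"
      by (intro subalgebra_generated_algebra assms(6)) (use k in auto)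
    have "AE \<omega> in M. real_cond_exp M (?F k) (d k) \<omega> = integral\<^sup>L M (d k)" "integral\<^sup>L M (d k) = 0"
      using assms(8) k unfolding mean_independent_mean_zero_def by blast+
    then show "AE \<omega> in M. real_cond_exp M (?F k) (d k) \<omega> = 0" by simp
  qed (use assms in auto)

  define c where "c = lam * u"
  define r where "r = sqrt (2 * ln (2 / \<delta>))"
  have "2 * real n / \<eta> > 1" "2 / \<delta> > 1"
    using True \<open>\<eta> > 0\<close> \<open>n \<ge> 2\<close> assms(15) by (auto simp: field_simps)
  then have lam: "0 \<le> lam" "lam\<^sup>2 = 2 * ln (2 * real n / \<eta>)" and r: "0 \<le> r" "r\<^sup>2 = 2 * ln (2 / \<delta>)"
    by (auto simp: assms(12) r_def)
  have tail_lam: "2 * exp (- lam\<^sup>2 / 2) = \<eta> / real n"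
    using \<open>\<eta> > 0\<close> \<open>n \<ge> 2\<close> by (simp add: lam(2) exp_minus)
  have tail_r: "2 * exp (- r\<^sup>2 / 2) = \<delta>"
    using assms(15) by (simp add: r(2) exp_minus)
  have c: "0 \<le> c" "c * sqrt (real h) < 1"
    using lam(1) \<open>0 < u\<close> assms(14) by (auto simp: c_def mult_ac)

  have tree: "step_vertices t (t n)" "labels (t n) \<subseteq># mset_set ?B"
    using general_summation_step_vertices[OF assms(2) \<open>n \<ge> 2\<close>] by auto
  define J where "J = set_mset (labels (t n))"
  have J: "J \<subseteq> ?B" "finite J"
    using set_mset_mono[OF tree(2)] by (auto simp: J_def)
  let ?g = "\<lambda>j \<omega>. truncated_weight c x (\<lambda>i. d i \<omega>) (t j)"
  let ?G = "\<lambda>j. local_bound c x (t j)"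
  let ?Y = "\<lambda>A \<omega>. \<Sum>j\<in>#A. d j \<omega> * ?g j \<omega>"
  have g_measurable: "?g j \<in> borel_measurable (?F j)" if j: "j \<in> J" for j
  proof -
    obtain a b where ab: "t j = Add j a b" "labels a + labels b \<subseteq># mset_set {2..<j}"
      using step_vertices_label[OF tree(1)] j unfolding J_def by blast
    have "i \<in> {2..<j}" if "i \<in># labels a + labels b" for i
      using set_mset_mono[OF ab(2)] that by auto
    then show ?thesis
      unfolding ab(1) by (intro truncated_weight_measurable generated_algebra_measurable)
  qed
  have Y_tail: "?Y A \<in> borel_measurable M"
      "prob {\<omega> \<in> space M. u * sqrt (\<Sum>j\<in>#A. (?G j)\<^sup>2) * q < \<bar>?Y A \<omega>\<bar>} \<le> 2 * exp (- q\<^sup>2 / 2)"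
    if A: "A \<subseteq># labels (t n)" and "0 \<le> q" for A q
  proof -
    have AJ: "set_mset A \<subseteq> J" using set_mset_mono[OF A] by (simp add: J_def)
    note to_set = sum_mset_eq_sum_if_subset_mset_set[OF subset_mset.order_trans[OF A tree(2)] finite_atLeastAtMost]
    show "?Y A \<in> borel_measurable M"
      unfolding to_set by (rule weighted_sum_measurable) (use AJ J g_measurable in auto)
    show "prob {\<omega> \<in> space M. u * sqrt (\<Sum>j\<in>#A. (?G j)\<^sup>2) * q < \<bar>?Y A \<omega>\<bar>} \<le> 2 * exp (- q\<^sup>2 / 2)"
      unfolding to_set
      by (rule weighted_sum_tail) (use AJ J g_measurable abs_truncated_weight_le c \<open>0 \<le> q\<close> in auto)
  qed

  \<comment> \<open>\<open>bad k\<close>: the truncated sum over the additions strictly below vertex \<open>k\<close> exceeds the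
    threshold for the error inherited at \<open>k\<close>.\<close>
  let ?below = "\<lambda>k. labels (t k) - {#k#}"
  define bad where "bad k = {\<omega> \<in> space M. inherited_bound c x (t k) < \<bar>?Y (?below k) \<omega>\<bar>}" for k
  define bad_root where
    "bad_root = {\<omega> \<in> space M. u * sqrt (energy c x (t n)) * r < \<bar>?Y (labels (t n)) \<omega>\<bar>}"
  have bad: "bad k \<in> events" "prob (bad k) \<le> \<eta> / real n" if k: "k \<in> J" for k
  proof -
    obtain a b where ab: "t k = Add k a b" "step_vertices t (t k)" "labels a + labels b \<subseteq># labels (t n)"
      using step_vertices_label[OF tree(1)] k unfolding J_def by blast
    have below: "?below k = labels a + labels b" by (simp add: ab(1))
    have bound: "inherited_bound c x (t k) = u * sqrt (\<Sum>j\<in>#?below k. (?G j)\<^sup>2) * lam"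
      unfolding below using ab(2) by (simp add: ab(1) energy_eq_sum[of t] c_def)
    note Y = Y_tail[OF ab(3) lam(1), folded below]
    show "bad k \<in> events" unfolding bad_def using Y(1) by measurable
    show "prob (bad k) \<le> \<eta> / real n" unfolding bad_def bound using Y(2) tail_lam by simp
  qed
  have bad_root: "bad_root \<in> events" "prob bad_root \<le> \<delta>"
  proof -
    note Y = Y_tail[OF subset_mset.order_refl r(1)]
    show "bad_root \<in> events" unfolding bad_root_def using Y(1) by measurable
    show "prob bad_root \<le> \<delta>"
      unfolding bad_root_def energy_eq_sum[OF tree(1)] using Y(2) tail_r by simp
  qed
  let ?bad = "bad_root \<union> (\<Union>k\<in>J. bad k)"
  have bad_events: "?bad \<in> events" using bad(1) bad_root(1) J(2) by auto
  have "prob ?bad \<le> prob bad_root + prob (\<Union>k\<in>J. bad k)"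
    using bad(1) bad_root(1) J(2) by (intro measure_Un_le) auto
  also have "prob (\<Union>k\<in>J. bad k) \<le> (\<Sum>k\<in>J. prob (bad k))"
    using bad(1) J(2) by (intro finite_measure_subadditive_finite) auto
  also have "\<dots> \<le> real (card J) * (\<eta> / real n)"
    using bad(2) by (intro sum_bounded_above)
  also have "\<dots> \<le> real n * (\<eta> / real n)"
    using card_mono[OF _ J(1)] \<open>\<eta> > 0\<close> by (intro mult_right_mono) auto
  also have "\<dots> = \<eta>" using \<open>n \<ge> 2\<close> by simp
  finally have "prob ?bad \<le> \<delta> + \<eta>" using bad_root(2) by simp
  then have good: "1 - (\<delta> + \<eta>) \<le> prob (space M - ?bad)"
    using prob_compl[OF bad_events] by simp

  let ?bound = "u / (1 - lam * sqrt (real h) * u) * sqrt (\<Sum>k=2..n. (s k)\<^sup>2) * r"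
  have err: "s_hat n \<omega> - s n = sum_error x (\<lambda>i. d i \<omega>) (t n)" for \<omega>
    by (simp add: assms(9,10) sum_error_def)
  have "space M - ?bad \<subseteq> {\<omega> \<in> space M. \<bar>s_hat n \<omega> - s n\<bar> \<le> ?bound}"
  proof
    fix \<omega> assume \<omega>: "\<omega> \<in> space M - ?bad"
    have "sum_error x (\<lambda>i. d i \<omega>) (t n) = ?Y (labels (t n)) \<omega>"
    proof (rule sum_error_eq_truncated_sum[OF tree(1)])
      fix k a b assume "k \<in># labels (t n)" and tk: "t k = Add k a b"
      then have "\<omega> \<notin> bad k" using \<omega> by (auto simp: J_def)
      moreover have "?below k = labels a + labels b" by (simp add: tk)
      ultimately show "\<bar>?Y (labels a + labels b) \<omega>\<bar> \<le> inherited_bound c x (t k)"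
        using \<omega> by (simp add: bad_def not_less)
    qed
    then have "\<bar>s_hat n \<omega> - s n\<bar> \<le> u * sqrt (energy c x (t n)) * r"
      using \<omega> by (simp add: err bad_root_def not_less)
    also have "\<dots> \<le> u * (sqrt (\<Sum>k=2..n. (s k)\<^sup>2) / (1 - c * sqrt (real h))) * r"
      using sqrt_energy_le[OF c(1) tree _ , of x] c(2) \<open>0 < u\<close> r(1)
      by (intro mult_right_mono mult_left_mono) (auto simp: assms(9,11))
    also have "\<dots> = ?bound" by (simp add: c_def mult_ac)
    finally show "\<omega> \<in> {\<omega> \<in> space M. \<bar>s_hat n \<omega> - s n\<bar> \<le> ?bound}" using \<omega> by simp
  qed
  moreover have "{\<omega> \<in> space M. \<bar>s_hat n \<omega> - s n\<bar> \<le> ?bound} \<in> events"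
  proof -
    have "(\<lambda>\<omega>. s_hat n \<omega>) \<in> borel_measurable M"
      unfolding assms(10) by (rule computed_value_measurable) (use J assms(6) in \<open>auto simp: J_def\<close>)
    then show ?thesis by measurable
  qed
  ultimately have "prob (space M - ?bad) \<le> prob {\<omega> \<in> space M. \<bar>s_hat n \<omega> - s n\<bar> \<le> ?bound}"
    by (rule finite_measure_mono)
  with good show ?thesis by (simp add: r_def)
qed

end
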